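(* Let $\varphi:\mathbb{D}\to\mathbb{D}$ be holomorphic. The following assertions are equivalent: (i) the composition operator $C_\varphi f=f\circ\varphi$ is compact as an operator from $\mathrm{Hol}(\mathbb{D})$ to $\mathrm{Hol}(\mathbb{D})$; (ii) $\sup_{z\in\mathbb{D}}|\varphi(z)|<1$.
   Context: $\mathbb{D}$ is the open unit disc and $\mathrm{Hol}(\mathbb{D})$ the Fréchet space of holomorphic functions on $\mathbb{D}$ with the topology of uniform convergence on compact subsets. A linear map $T:X\to X$ on a Fréchet space $X$ is compact if there exists a neighborhood $\mathcal{V}$ of $0$ such that $T\mathcal{V}$ is relatively compact. *)

theory Defs
  imports "HOL-Complex_Analysis.Complex_Analysis"
begin

abbreviation unit_disc :: "complex set" where
  "unit_disc \<equiv> ball 0 1"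

(* Functions on the disc are total functions on the plane that vanish off the disc. This makes
   equality of functions equality on the disc, and Hol_disc a linear subspace under pointwise
   operations. *)
definition Hol_disc :: "(complex \<Rightarrow> complex) set" where
  "Hol_disc = {f. f holomorphic_on unit_disc \<and> (\<forall>z. z \<notin> unit_disc \<longrightarrow> f z = 0)}"

definition Hol_nbhd :: "complex set \<Rightarrow> real \<Rightarrow> (complex \<Rightarrow> complex) \<Rightarrow> (complex \<Rightarrow> complex) set" where
  "Hol_nbhd K e f = {g \<in> Hol_disc. \<forall>z\<in>K. dist (g z) (f z) < e}"

(* Uniform convergence on compact subsets of the disc; see limitin_Hol_topology. *)
definition Hol_topology :: "(complex \<Rightarrow> complex) topology" where
  "Hol_topology = topology (\<lambda>U. U \<subseteq> Hol_disc \<and>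
     (\<forall>f\<in>U. \<exists>K e. compact K \<and> K \<subseteq> unit_disc \<and> e > 0 \<and> Hol_nbhd K e f \<subseteq> U))"

lemma openin_Hol_topology:
  "openin Hol_topology U \<longleftrightarrow> U \<subseteq> Hol_disc \<and>
     (\<forall>f\<in>U. \<exists>K e. compact K \<and> K \<subseteq> unit_disc \<and> e > 0 \<and> Hol_nbhd K e f \<subseteq> U)"
proof -
  let ?P = "\<lambda>U. U \<subseteq> Hol_disc \<and>
     (\<forall>f\<in>U. \<exists>K e. compact K \<and> K \<subseteq> unit_disc \<and> e > 0 \<and> Hol_nbhd K e f \<subseteq> U)"
  have inter: "?P (S \<inter> T)" if S: "?P S" and T: "?P T" for S T
  proof (intro conjI ballI)
    show "S \<inter> T \<subseteq> Hol_disc" using S by blast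
    fix f assume f: "f \<in> S \<inter> T"
    obtain K e where K: "compact K" "K \<subseteq> unit_disc" "e > 0" "Hol_nbhd K e f \<subseteq> S"
      using S f by blast
    obtain L d where L: "compact L" "L \<subseteq> unit_disc" "d > 0" "Hol_nbhd L d f \<subseteq> T"
      using T f by blast
    have "Hol_nbhd (K \<union> L) (min e d) f \<subseteq> Hol_nbhd K e f \<inter> Hol_nbhd L d f"
      by (auto simp: Hol_nbhd_def)
    then show "\<exists>K e. compact K \<and> K \<subseteq> unit_disc \<and> e > 0 \<and> Hol_nbhd K e f \<subseteq> S \<inter> T"
      using K L by (intro exI[of _ "K \<union> L"] exI[of _ "min e d"]) auto
  qed
  have union: "?P (\<Union>\<K>)" if P: "\<forall>S\<in>\<K>. ?P S" for \<K>
  proof (intro conjI ballI)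
    show "\<Union>\<K> \<subseteq> Hol_disc" by (rule Union_least) (use P in simp)
    fix f assume "f \<in> \<Union>\<K>"
    then obtain S where S: "S \<in> \<K>" "f \<in> S" by blast
    then obtain K e where "compact K" "K \<subseteq> unit_disc" "e > 0" "Hol_nbhd K e f \<subseteq> S"
      using P[rule_format, OF S(1)] S(2) by blast
    then have "\<exists>K e. compact K \<and> K \<subseteq> unit_disc \<and> e > 0 \<and> Hol_nbhd K e f \<subseteq> S"
      by blast
    then show "\<exists>K e. compact K \<and> K \<subseteq> unit_disc \<and> e > 0 \<and> Hol_nbhd K e f \<subseteq> \<Union>\<K>"
      using S(1) by (meson Union_upper order_trans)
  qed
  have "istopology ?P"
    unfolding istopology_def
    by (rule conjI; intro allI impI; rule inter union; assumption)
  then show ?thesis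
    unfolding Hol_topology_def by (simp add: topology_inverse')
qed

lemma topspace_Hol_topology: "topspace Hol_topology = Hol_disc"
proof -
  have "Hol_nbhd {} 1 f \<subseteq> Hol_disc" for f
    by (auto simp: Hol_nbhd_def)
  moreover have "compact ({} :: complex set)" "{} \<subseteq> unit_disc" "(1::real) > 0"
    by simp_all
  ultimately have "openin Hol_topology Hol_disc"
    unfolding openin_Hol_topology by blast
  then have "Hol_disc \<subseteq> topspace Hol_topology"
    by (rule openin_subset)
  moreover have "topspace Hol_topology \<subseteq> Hol_disc"
    using openin_topspace[of Hol_topology] unfolding openin_Hol_topology[of "topspace _"] by (rule conjunct1)
  ultimately show ?thesis by (rule subset_antisym[rotated])
qed

lemma openin_Hol_nbhd:
  assumes f: "f \<in> Hol_disc" and K: "compact K" "K \<subseteq> unit_disc"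
  shows "openin Hol_topology (Hol_nbhd K e f)"
  unfolding openin_Hol_topology
proof (intro conjI ballI)
  show "Hol_nbhd K e f \<subseteq> Hol_disc" by (auto simp: Hol_nbhd_def)
  fix g assume g: "g \<in> Hol_nbhd K e f"
  have "\<exists>d>0. Hol_nbhd K d g \<subseteq> Hol_nbhd K e f"
  proof (cases "K = {}")
    case True
    then show ?thesis by (auto simp: Hol_nbhd_def intro: exI[of _ 1])
  next
    case False
    have "continuous_on K f" "continuous_on K g"
      using f g K by (auto simp: Hol_nbhd_def Hol_disc_def
          intro: holomorphic_on_imp_continuous_on continuous_on_subset)
    then have "continuous_on K (\<lambda>z. dist (g z) (f z))"
      by (intro continuous_intros)
    then obtain w where w: "w \<in> K" "\<And>z. z \<in> K \<Longrightarrow> dist (g z) (f z) \<le> dist (g w) (f w)"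
      using continuous_attains_sup[OF K(1) False] by blast
    let ?d = "e - dist (g w) (f w)"
    have "Hol_nbhd K ?d g \<subseteq> Hol_nbhd K e f"
    proof
      fix h assume h: "h \<in> Hol_nbhd K ?d g"
      have "dist (h z) (f z) < e" if "z \<in> K" for z
      proof -
        have "dist (h z) (g z) < ?d" using h that by (auto simp: Hol_nbhd_def)
        then show ?thesis using w(2)[OF that] dist_triangle[of "h z" "f z" "g z"] by linarith
      qed
      then show "h \<in> Hol_nbhd K e f" using h by (auto simp: Hol_nbhd_def)
    qed
    moreover have "?d > 0" using g w(1) by (auto simp: Hol_nbhd_def)
    ultimately show ?thesis by blast
  qed
  then show "\<exists>L d. compact L \<and> L \<subseteq> unit_disc \<and> d > 0 \<and> Hol_nbhd L d g \<subseteq> Hol_nbhd K e f"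
    using K by blast
qed

lemma limitin_Hol_topology:
  assumes F: "\<forall>\<^sub>F n in A. F n \<in> Hol_disc"
  shows "limitin Hol_topology F f A \<longleftrightarrow>
    f \<in> Hol_disc \<and> (\<forall>K. compact K \<and> K \<subseteq> unit_disc \<longrightarrow> uniform_limit K F f A)"
proof (intro iffI conjI allI impI)
  assume lim: "limitin Hol_topology F f A"
  then show f: "f \<in> Hol_disc"
    by (simp add: limitin_def topspace_Hol_topology)
  fix K assume K: "compact K \<and> K \<subseteq> unit_disc"
  show "uniform_limit K F f A"
  proof (rule uniform_limitI)
    fix e :: real assume "e > 0"
    then have "f \<in> Hol_nbhd K e f" using f by (simp add: Hol_nbhd_def)
    then have "\<forall>\<^sub>F n in A. F n \<in> Hol_nbhd K e f"
      using lim openin_Hol_nbhd[OF f, of K e] K by (auto simp: limitin_def)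
    then show "\<forall>\<^sub>F n in A. \<forall>z\<in>K. dist (F n z) (f z) < e"
      by eventually_elim (simp add: Hol_nbhd_def)
  qed
next
  assume f: "f \<in> Hol_disc \<and> (\<forall>K. compact K \<and> K \<subseteq> unit_disc \<longrightarrow> uniform_limit K F f A)"
  show "limitin Hol_topology F f A"
    unfolding limitin_def topspace_Hol_topology
  proof (intro conjI allI impI)
    show "f \<in> Hol_disc" using f by simp
    fix U assume "openin Hol_topology U \<and> f \<in> U"
    then obtain K e where K: "compact K" "K \<subseteq> unit_disc" "e > 0" "Hol_nbhd K e f \<subseteq> U"
      unfolding openin_Hol_topology by blast
    then have "\<forall>\<^sub>F n in A. \<forall>z\<in>K. dist (F n z) (f z) < e"
      using f by (blast dest: uniform_limitD)
    with F show "\<forall>\<^sub>F n in A. F n \<in> U"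
      by eventually_elim (use K(4) in \<open>auto simp: Hol_nbhd_def\<close>)
  qed
qed

definition linear_operator_on ::
  "(complex \<Rightarrow> complex) set \<Rightarrow> ((complex \<Rightarrow> complex) \<Rightarrow> (complex \<Rightarrow> complex)) \<Rightarrow> bool" where
  "linear_operator_on S T \<longleftrightarrow> T ` S \<subseteq> S \<and>
     (\<forall>f\<in>S. \<forall>g\<in>S. T (\<lambda>z. f z + g z) = (\<lambda>z. T f z + T g z)) \<and>
     (\<forall>c. \<forall>f\<in>S. T (\<lambda>z. c * f z) = (\<lambda>z. c * T f z))"

(* X is a topological vector space of functions with pointwise operations, so its zero is the
   zero function; V ranges over neighbourhoods of zero, not necessarily open. *)
definition compact_operator ::
  "(complex \<Rightarrow> complex) topology \<Rightarrow> ((complex \<Rightarrow> complex) \<Rightarrow> (complex \<Rightarrow> complex)) \<Rightarrow> bool" where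
  "compact_operator X T \<longleftrightarrow> linear_operator_on (topspace X) T \<and>
     (\<exists>V. V \<subseteq> topspace X \<and> (\<exists>U. openin X U \<and> (\<lambda>z. 0) \<in> U \<and> U \<subseteq> V) \<and>
          compactin X (X closure_of (T ` V)))"

definition composition_operator ::
  "(complex \<Rightarrow> complex) \<Rightarrow> (complex \<Rightarrow> complex) \<Rightarrow> (complex \<Rightarrow> complex)" where
  "composition_operator \<phi> f = (\<lambda>z. if z \<in> unit_disc then (f \<circ> \<phi>) z else 0)"

end

theory Submission
  imports Defs
begin

text \<open>
  If \<open>C\<^sub>\<phi>\<close> is compact, it maps some \<open>{f. \<bar>f\<bar> < e on cball 0 r}\<close> with \<open>r < 1\<close> to a set on which
  point evaluations are bounded; testing with \<open>(e/2) (w/\<rho>)\<^sup>n\<close> for \<open>r < \<rho> < \<bar>\<phi> z\<bar>\<close> shows that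
  \<open>\<bar>\<phi> z\<bar> \<le> r\<close> for every \<open>z\<close>.
  Conversely, if \<open>\<bar>\<phi>\<bar> \<le> s < 1\<close>, then \<open>C\<^sub>\<phi>\<close> maps \<open>{f. \<bar>f\<bar> < 1 on cball 0 s}\<close> into the functions
  bounded by \<open>1\<close>. By Cauchy's estimates these have Taylor coefficients in the closed unit disc, so
  they lie in the image of a product of closed discs, compact by Tychonoff, under the map
  \<open>a \<mapsto> \<Sum>n. a\<^sub>n z\<^sup>n\<close>, which is continuous into \<open>Hol(\<D>)\<close>.
\<close>

section \<open>Compact subsets of the disc, the operator on Hol(D), and the Hausdorff
  property\<close>

lemma compact_subset_unit_disc:
  assumes "compact K" "K \<subseteq> unit_disc"
  obtains r where "0 < r" "r < 1" "K \<subseteq> cball 0 r"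
proof (cases "K = {}")
  case True
  then show ?thesis using that[of "1/2"] by simp
next
  case False
  obtain w where w: "w \<in> K" "\<And>z. z \<in> K \<Longrightarrow> norm z \<le> norm w"
    using continuous_attains_sup[OF assms(1) False continuous_on_norm_id] by blast
  \<comment> \<open>The lower bound 1/2 keeps the radius positive when \<open>K\<close> is just the
    origin.\<close>
  show ?thesis
  proof (rule that[of "max (norm w) (1/2)"])
    show "max (norm w) (1/2) < 1" using w(1) assms(2) by auto
    show "K \<subseteq> cball 0 (max (norm w) (1/2))" using w(2) by force
  qed auto
qed

lemma zero_in_Hol_disc: "(\<lambda>z. 0) \<in> Hol_disc"
  by (simp add: Hol_disc_def)

lemma composition_operator_in_Hol_disc:
  assumes "\<phi> holomorphic_on unit_disc" "\<phi> ` unit_disc \<subseteq> unit_disc" "f \<in> Hol_disc"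
  shows "composition_operator \<phi> f \<in> Hol_disc"
proof -
  have "(f \<circ> \<phi>) holomorphic_on unit_disc"
    using assms by (auto simp: Hol_disc_def intro: holomorphic_on_compose_gen)
  then have "composition_operator \<phi> f holomorphic_on unit_disc"
    by (rule holomorphic_transform) (simp add: composition_operator_def)
  then show ?thesis
    by (simp add: Hol_disc_def composition_operator_def)
qed

lemma linear_composition_operator:
  assumes "\<phi> holomorphic_on unit_disc" "\<phi> ` unit_disc \<subseteq> unit_disc"
  shows "linear_operator_on Hol_disc (composition_operator \<phi>)"
  unfolding linear_operator_on_def
proof (intro conjI ballI allI)
  show "composition_operator \<phi> ` Hol_disc \<subseteq> Hol_disc"
    using composition_operator_in_Hol_disc[OF assms] by blast
qed (simp_all add: composition_operator_def fun_eq_iff)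

text \<open>Needed later so that a compact set of functions is closed and hence contains the closure
  of each of its subsets. Members of \<open>Hol_disc\<close> vanish off the disc, so two distinct
  ones differ at a point of the disc, and evaluation there separates them.\<close>

lemma Hausdorff_space_Hol_topology: "Hausdorff_space Hol_topology"
  unfolding Hausdorff_space_def topspace_Hol_topology
proof (intro allI impI)
  fix f g assume fg: "f \<in> Hol_disc \<and> g \<in> Hol_disc \<and> f \<noteq> g"
  then obtain z where z: "f z \<noteq> g z" by blast
  with fg have zD: "z \<in> unit_disc" by (auto simp: Hol_disc_def)
  let ?e = "dist (f z) (g z) / 2"
  have "disjnt (Hol_nbhd {z} ?e f) (Hol_nbhd {z} ?e g)"
    unfolding disjnt_iff
  proof (intro allI notI)
    fix h assume "h \<in> Hol_nbhd {z} ?e f \<and> h \<in> Hol_nbhd {z} ?e g"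
    then have "dist (h z) (f z) < ?e" "dist (h z) (g z) < ?e"
      by (simp_all add: Hol_nbhd_def)
    then show False using dist_triangle3[of "f z" "g z" "h z"] by linarith
  qed
  moreover have "f \<in> Hol_nbhd {z} ?e f" "g \<in> Hol_nbhd {z} ?e g"
    using fg z by (simp_all add: Hol_nbhd_def)
  ultimately show "\<exists>U V. openin Hol_topology U \<and> openin Hol_topology V \<and> f \<in> U \<and> g \<in> V \<and> disjnt U V"
    using openin_Hol_nbhd[of f "{z}" ?e] openin_Hol_nbhd[of g "{z}" ?e] fg zD
    by (intro exI[of _ "Hol_nbhd {z} ?e f"] exI[of _ "Hol_nbhd {z} ?e g"]) simp
qed

section \<open>Compactness of the operator bounds \<phi> away from the unit circle\<close>

text \<open>The open sets of functions with modulus below m at \<open>z\<close>, for natural m,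
  cover the whole space; a finite subcover of \<open>C\<close> gives the bound.\<close>

lemma compactin_Hol_topology_bounded_at:
  assumes C: "compactin Hol_topology C" and z: "z \<in> unit_disc"
  obtains M where "\<And>g. g \<in> C \<Longrightarrow> norm (g z) \<le> M"
proof -
  define W where "W = (\<lambda>m::nat. Hol_nbhd {z} (real m) (\<lambda>z. 0))"
  have "openin Hol_topology U" if "U \<in> range W" for U
    using that z zero_in_Hol_disc by (auto simp: W_def intro!: openin_Hol_nbhd)
  moreover have "C \<subseteq> \<Union>(range W)"
  proof
    fix g assume "g \<in> C"
    then have "g \<in> Hol_disc"
      using C compactin_subset_topspace topspace_Hol_topology by blast
    moreover obtain m where "norm (g z) < real m" using reals_Archimedean2 by blast
    ultimately show "g \<in> \<Union>(range W)" by (auto simp: W_def Hol_nbhd_def)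
  qed
  ultimately obtain \<F> where \<F>: "finite \<F>" "\<F> \<subseteq> range W" "C \<subseteq> \<Union>\<F>"
    using compactinD[OF C, of "range W"] by metis
  obtain I where I: "finite I" "\<F> = W ` I"
    using finite_subset_image[OF \<F>(1,2)] by blast
  \<comment> \<open>If \<open>I\<close> is empty then so is \<open>C\<close>, so the unspecified
    value of \<open>Max {}\<close> does no harm.\<close>
  show ?thesis
  proof (rule that[of "real (Max I)"])
    fix g assume "g \<in> C"
    then obtain i where i: "i \<in> I" "g \<in> W i" using \<F>(3) I(2) by blast
    have "norm (g z) \<le> real i" using i(2) by (simp add: W_def Hol_nbhd_def)
    also have "\<dots> \<le> real (Max I)" using Max_ge[OF I(1) i(1)] by simp
    finally show "norm (g z) \<le> real (Max I)" .
  qed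
qed

lemma compact_composition_operator_imp_bound:
  assumes "compact_operator Hol_topology (composition_operator \<phi>)"
    and \<phi>: "\<phi> ` unit_disc \<subseteq> unit_disc"
  obtains r where "r < 1" "\<And>z. z \<in> unit_disc \<Longrightarrow> norm (\<phi> z) \<le> r"
proof -
  let ?T = "composition_operator \<phi>"
  have lin: "?T ` Hol_disc \<subseteq> Hol_disc"
    using assms(1)
    unfolding compact_operator_def linear_operator_on_def topspace_Hol_topology by (elim conjE)
  obtain V U where V: "V \<subseteq> Hol_disc" "openin Hol_topology U" "(\<lambda>z. 0) \<in> U" "U \<subseteq> V"
    and comp: "compactin Hol_topology (Hol_topology closure_of (?T ` V))"
    using assms(1) unfolding compact_operator_def topspace_Hol_topology by (elim conjE exE) (rule that)
  obtain K e where K: "compact K" "K \<subseteq> unit_disc" "e > 0" "Hol_nbhd K e (\<lambda>z. 0) \<subseteq> U"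
    using V(2,3) unfolding openin_Hol_topology by blast
  obtain r where r: "0 < r" "r < 1" "K \<subseteq> cball 0 r"
    using compact_subset_unit_disc K by blast
  have TV: "?T ` V \<subseteq> Hol_topology closure_of (?T ` V)"
    using lin V(1) by (intro closure_of_subset) (auto simp: topspace_Hol_topology)
  have "norm (\<phi> z) \<le> r" if z: "z \<in> unit_disc" for z
  proof (rule ccontr)
    have \<phi>z: "norm (\<phi> z) < 1" using \<phi> z by (force simp: image_subset_iff)
    assume "\<not> norm (\<phi> z) \<le> r"
    then obtain \<rho> where \<rho>: "r < \<rho>" "\<rho> < norm (\<phi> z)" using dense by (meson not_le)
    \<comment> \<open>On \<open>K\<close> the power has modulus at most 1, with equality for n = 0,
      so the factor e/2 is what makes the bound by \<open>e\<close> strict. The cutoff off the disc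
      is invisible at \<open>\<phi> z\<close>, which lies inside it.\<close>
    define f where "f = (\<lambda>n w. if w \<in> unit_disc then of_real (e / 2) * (w / of_real \<rho>) ^ n else (0::complex))"
    have "f n \<in> Hol_nbhd K e (\<lambda>z. 0)" for n
    proof -
      have "(\<lambda>w. of_real (e / 2) * (w / of_real \<rho>) ^ n) holomorphic_on unit_disc"
        using r(1) \<rho>(1) by (intro holomorphic_intros) auto
      then have "f n holomorphic_on unit_disc"
        by (rule holomorphic_transform) (simp add: f_def)
      then have "f n \<in> Hol_disc" by (simp add: Hol_disc_def f_def)
      moreover have "norm (f n w) < e" if "w \<in> K" for w
      proof -
        have "norm w \<le> r" using r(3) that by auto
        then have "(norm w / \<rho>) ^ n \<le> 1"
          using r(1) \<rho>(1) by (intro power_le_one) auto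
        then have "e / 2 * (norm w / \<rho>) ^ n \<le> e / 2"
          using K(3) by (simp add: mult_left_le)
        then show ?thesis
          using K(3) r(1) \<rho>(1) by (simp add: f_def norm_mult norm_power norm_divide)
      qed
      ultimately show ?thesis by (simp add: Hol_nbhd_def)
    qed
    then have mem: "?T (f n) \<in> Hol_topology closure_of (?T ` V)" for n
      using K(4) V(4) TV by blast
    obtain M where M: "\<And>g. g \<in> Hol_topology closure_of (?T ` V) \<Longrightarrow> norm (g z) \<le> M"
      using compactin_Hol_topology_bounded_at[OF comp z] by blast
    have bound: "e / 2 * (norm (\<phi> z) / \<rho>) ^ n \<le> M" for n
      using M[OF mem[of n]] z \<phi>z K(3) r(1) \<rho>(1)
      by (simp add: f_def composition_operator_def norm_mult norm_power norm_divide)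
    \<comment> \<open>At \<open>z\<close> the images of the test functions grow geometrically,
      against the bound \<open>M\<close>, which does not depend on n.\<close>
    have "1 < norm (\<phi> z) / \<rho>" using r(1) \<rho> by simp
    then obtain n where "M / (e / 2) < (norm (\<phi> z) / \<rho>) ^ n"
      using real_arch_pow by blast
    then have "M < e / 2 * (norm (\<phi> z) / \<rho>) ^ n"
      using K(3) by (subst (asm) pos_divide_less_eq) (simp_all only: mult.commute half_gt_zero)
    then show False using bound[of n] by linarith
  qed
  then show ?thesis by (rule that[OF r(2)])
qed

section \<open>A compact set of power series containing all functions bounded by 1\<close>

definition disc_power_series :: "(nat \<Rightarrow> complex) \<Rightarrow> complex \<Rightarrow> complex" where
  "disc_power_series a z = (if z \<in> unit_disc then \<Sum>n. a n * z ^ n else 0)"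

lemma summable_bounded_coeffs:
  fixes a :: "nat \<Rightarrow> complex"
  assumes "\<And>n. norm (a n) \<le> C" "norm z < 1"
  shows "summable (\<lambda>n. a n * z ^ n)"
proof (rule summable_comparison_test')
  show "summable (\<lambda>n. C * norm z ^ n)"
    using assms(2) by (intro summable_mult summable_geometric) simp
  show "norm (a n * z ^ n) \<le> C * norm z ^ n" for n
    using assms(1) by (simp add: norm_mult norm_power mult_right_mono)
qed

lemma disc_power_series_in_Hol_disc:
  assumes "\<And>n. norm (a n) \<le> C"
  shows "disc_power_series a \<in> Hol_disc"
proof -
  have "(\<lambda>n. a n * (w - 0) ^ n) sums disc_power_series a w" if "w \<in> unit_disc" for w
    using summable_sums[OF summable_bounded_coeffs[OF assms]] that
    by (simp add: disc_power_series_def)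
  then have "disc_power_series a holomorphic_on unit_disc"
    by (rule power_series_holomorphic)
  then show ?thesis by (simp add: Hol_disc_def disc_power_series_def)
qed

text \<open>The difference series is split at \<open>N\<close>. Each of the first \<open>N\<close>
  terms is at most \<open>d\<close>; in the tail, coefficients differ by at most 2, which leaves a
  geometric series in \<open>r\<close>. The estimate is uniform in \<open>z\<close> and involves
  only finitely many coefficients, as continuity for the product topology requires.\<close>

lemma dist_disc_power_series_le:
  assumes ab: "\<And>n. norm (a n) \<le> 1" "\<And>n. norm (b n) \<le> 1"
    and z: "norm z \<le> r" and r: "0 < r" "r < 1"
    and d: "\<And>n. n < N \<Longrightarrow> dist (b n) (a n) \<le> d"
  shows "dist (disc_power_series b z) (disc_power_series a z) \<le> real N * d + 2 * r ^ N / (1 - r)"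
proof -
  have z1: "norm z < 1" using z r by linarith
  define t where "t = (\<lambda>n. b n * z ^ n - a n * z ^ n)"
  have sums: "summable (\<lambda>n. b n * z ^ n)" "summable (\<lambda>n. a n * z ^ n)"
    using summable_bounded_coeffs[OF ab(2) z1] summable_bounded_coeffs[OF ab(1) z1] .
  then have t: "summable t" unfolding t_def by (rule summable_diff)
  have norm_t: "norm (t n) = dist (b n) (a n) * norm z ^ n" for n
    by (simp add: t_def dist_norm norm_mult norm_power flip: left_diff_distrib)
  have "norm (t n) \<le> d" if "n < N" for n
  proof -
    have "norm (t n) \<le> dist (b n) (a n)"
      using z1 by (simp add: norm_t mult_left_le power_le_one)
    then show ?thesis using d[OF that] by linarith
  qed
  then have head: "norm (\<Sum>n<N. t n) \<le> real N * d"
    using sum_norm_bound[of "{..<N}" t d] by simp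
  have geo: "(\<lambda>n. 2 * r ^ N * r ^ n) sums (2 * r ^ N * (1 / (1 - r)))"
    using r by (intro sums_mult geometric_sums) simp
  have le: "norm (t (n + N)) \<le> 2 * r ^ N * r ^ n" for n
  proof -
    have "dist (b (n + N)) (a (n + N)) \<le> 2"
      using ab norm_triangle_ineq4[of "b (n + N)" "a (n + N)"]
      by (smt (verit) dist_norm)
    moreover have "norm z ^ (n + N) \<le> r ^ (n + N)"
      using z by (intro power_mono) auto
    ultimately have "norm (t (n + N)) \<le> 2 * r ^ (n + N)"
      unfolding norm_t by (intro mult_mono) auto
    then show ?thesis by (simp add: power_add mult_ac)
  qed
  have "norm (\<Sum>n. t (n + N)) \<le> (\<Sum>n. 2 * r ^ N * r ^ n)"
    using le by (rule norm_suminf_le) (rule sums_summable[OF geo])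
  then have tail: "norm (\<Sum>n. t (n + N)) \<le> 2 * r ^ N / (1 - r)"
    using sums_unique[OF geo] by simp
  have "dist (disc_power_series b z) (disc_power_series a z) = norm (suminf t)"
    using z1 suminf_diff[OF sums] by (simp add: disc_power_series_def dist_norm t_def)
  also have "suminf t = (\<Sum>n. t (n + N)) + (\<Sum>n<N. t n)"
    by (rule suminf_split_initial_segment[OF t])
  finally show ?thesis
    using head tail norm_triangle_ineq[of "\<Sum>n. t (n + N)" "\<Sum>n<N. t n"] by linarith
qed

definition coeff_topology :: "(nat \<Rightarrow> complex) topology" where
  "coeff_topology = product_topology (\<lambda>_. euclidean) UNIV"

definition unit_coeffs :: "(nat \<Rightarrow> complex) set" where
  "unit_coeffs = (\<Pi>\<^sub>E n\<in>UNIV. cball 0 1)"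

lemma unit_coeffs_iff: "a \<in> unit_coeffs \<longleftrightarrow> (\<forall>n. norm (a n) \<le> 1)"
  by (auto simp: unit_coeffs_def PiE_iff)

lemma compactin_unit_coeffs: "compactin coeff_topology unit_coeffs"
  unfolding coeff_topology_def unit_coeffs_def compactin_PiE by simp

text \<open>The set is a box whose factors are balls in the first \<open>N\<close> coordinates and
  the whole plane in all others.\<close>

lemma openin_coeff_topology:
  assumes "d > 0"
  shows "openin coeff_topology {b. \<forall>n<N. dist (b n) (a n) < d}"
proof -
  have "{b. \<forall>n<N. dist (b n) (a n) < d} = (\<Pi>\<^sub>E n\<in>UNIV. if n < N then ball (a n) d else UNIV)"
    by (auto simp: PiE_iff dist_commute split: if_splits)
  moreover have "finite {n. (if n < N then ball (a n) d else UNIV) \<noteq> UNIV}"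
    by (rule finite_subset[of _ "{..<N}"]) auto
  ultimately show ?thesis
    unfolding coeff_topology_def by (simp add: openin_PiE_gen)
qed

lemma continuous_map_disc_power_series:
  "continuous_map (subtopology coeff_topology unit_coeffs) Hol_topology disc_power_series"
proof -
  have top: "topspace (subtopology coeff_topology unit_coeffs) = unit_coeffs"
    using compactin_subset_topspace[OF compactin_unit_coeffs] by auto
  have "\<exists>T. openin (subtopology coeff_topology unit_coeffs) T \<and> a \<in> T \<and>
          T \<subseteq> {a \<in> unit_coeffs. disc_power_series a \<in> U}"
    if U: "openin Hol_topology U" and a: "a \<in> unit_coeffs" "disc_power_series a \<in> U" for U a
  proof -
    obtain K e where K: "compact K" "K \<subseteq> unit_disc" "e > 0" "Hol_nbhd K e (disc_power_series a) \<subseteq> U"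
      using U a(2) unfolding openin_Hol_topology by blast
    obtain r where r: "0 < r" "r < 1" "K \<subseteq> cball 0 r"
      using compact_subset_unit_disc K by blast
    \<comment> \<open>The error \<open>e\<close> is shared: \<open>N\<close> makes the tail strictly
      less than e/2, then \<open>d\<close> keeps the head at most e/2. The summand 1 in
      \<open>d\<close> avoids a zero denominator when \<open>N\<close> is 0.\<close>
    obtain N where "r ^ N < e * (1 - r) / 4"
      using real_arch_pow_inv[of "e * (1 - r) / 4" r] K(3) r by auto
    then have N: "2 * r ^ N / (1 - r) < e / 2"
      using r by (simp add: field_simps)
    define d where "d = e / (2 * (real N + 1))"
    have d: "d > 0" "real N * d \<le> e / 2"
      using K(3) by (auto simp: d_def field_simps)
    let ?T = "unit_coeffs \<inter> {b. \<forall>n<N. dist (b n) (a n) < d}"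
    have "disc_power_series b \<in> Hol_nbhd K e (disc_power_series a)" if b: "b \<in> ?T" for b
    proof -
      have "dist (disc_power_series b z) (disc_power_series a z) < e" if "z \<in> K" for z
      proof -
        have "dist (disc_power_series b z) (disc_power_series a z) \<le> real N * d + 2 * r ^ N / (1 - r)"
          using a(1) b r that
          by (intro dist_disc_power_series_le) (auto simp: unit_coeffs_iff less_imp_le)
        then show ?thesis using N d(2) by linarith
      qed
      moreover have "disc_power_series b \<in> Hol_disc"
        using b by (intro disc_power_series_in_Hol_disc[of _ 1]) (simp add: unit_coeffs_iff)
      ultimately show ?thesis by (simp add: Hol_nbhd_def)
    qed
    then have "?T \<subseteq> {a \<in> unit_coeffs. disc_power_series a \<in> U}"
      using K(4) by blast
    moreover have "openin (subtopology coeff_topology unit_coeffs) ?T"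
      by (rule openin_subtopology_Int2[OF openin_coeff_topology[OF d(1)]])
    ultimately show ?thesis using a(1) d(1) by (intro exI[of _ ?T]) auto
  qed
  \<comment> \<open>The preimage of \<open>U\<close> is open because it contains an open
    neighbourhood of each of its points.\<close>
  then have "openin (subtopology coeff_topology unit_coeffs)
      {a \<in> unit_coeffs. disc_power_series a \<in> U}" if "openin Hol_topology U" for U
    using that by (subst openin_subopen) blast
  moreover have "disc_power_series ` unit_coeffs \<subseteq> Hol_disc"
    by (auto simp: unit_coeffs_iff intro: disc_power_series_in_Hol_disc[of _ 1])
  ultimately show ?thesis
    unfolding continuous_map top topspace_Hol_topology by blast
qed

lemma compactin_disc_power_series_image:
  "compactin Hol_topology (disc_power_series ` unit_coeffs)"
  using continuous_map_disc_power_series compactin_unit_coeffs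
  by (intro image_compactin) (auto simp: compactin_subtopology)

text \<open>The coefficients are those of the Taylor series at 0. Cauchy's inequality needs a closed
  disc inside the domain, so it is applied at radius r < 1, and r then tends to 1.\<close>

lemma bounded_Hol_disc_is_disc_power_series:
  assumes f: "f \<in> Hol_disc" and bound: "\<And>z. z \<in> unit_disc \<Longrightarrow> norm (f z) \<le> 1"
  shows "f \<in> disc_power_series ` unit_coeffs"
proof -
  have hol: "f holomorphic_on unit_disc" using f by (simp add: Hol_disc_def)
  define a where "a = (\<lambda>n. (deriv ^^ n) f 0 / fact n)"
  have "norm (a n) \<le> 1" for n
  proof -
    have "norm (a n) * r ^ n \<le> 1" if r: "0 < r" "r < 1" for r
    proof -
      have sub: "cball 0 r \<subseteq> unit_disc" using r by auto
      have "norm ((deriv ^^ n) f 0) \<le> fact n * 1 / r ^ n"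
      proof (rule Cauchy_inequality)
        show "f holomorphic_on ball 0 r"
          using hol sub ball_subset_cball by (meson holomorphic_on_subset order_trans)
        show "continuous_on (cball 0 r) f"
          using hol sub holomorphic_on_imp_continuous_on continuous_on_subset by blast
        show "norm (f x) \<le> 1" if "norm (0 - x) = r" for x
          using that r bound[of x] by simp
      qed (use r in simp)
      then show ?thesis using r by (simp add: a_def norm_divide field_simps)
    qed
    then have "eventually (\<lambda>r. norm (a n) * r ^ n \<le> 1) (at_left (1::real))"
      unfolding eventually_at_left_field by (intro exI[of _ 0]) auto
    moreover have "((\<lambda>r. norm (a n) * r ^ n) \<longlongrightarrow> norm (a n) * 1 ^ n) (at_left (1::real))"
      by (intro tendsto_intros)
    ultimately have "norm (a n) * 1 ^ n \<le> 1"
      by (intro tendsto_upperbound) auto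
    then show ?thesis by simp
  qed
  then have "a \<in> unit_coeffs" by (simp add: unit_coeffs_iff)
  moreover have "f = disc_power_series a"
  proof
    fix z
    show "f z = disc_power_series a z"
    proof (cases "z \<in> unit_disc")
      case True
      then show ?thesis
        using sums_unique[OF holomorphic_power_series[OF hol True]]
        by (simp add: disc_power_series_def a_def)
    next
      case False
      then show ?thesis using f by (simp add: Hol_disc_def disc_power_series_def)
    qed
  qed
  ultimately show ?thesis by blast
qed

section \<open>A bound on \<phi> makes the operator compact\<close>

lemma compact_composition_operator:
  assumes "\<phi> holomorphic_on unit_disc" "\<phi> ` unit_disc \<subseteq> unit_disc"
    and s: "s < 1" "\<And>z. z \<in> unit_disc \<Longrightarrow> norm (\<phi> z) \<le> s"
  shows "compact_operator Hol_topology (composition_operator \<phi>)"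
proof -
  let ?T = "composition_operator \<phi>" and ?C = "disc_power_series ` unit_coeffs"
  \<comment> \<open>The values of \<phi> lie in \<open>cball 0 s\<close>, a compact subset of the
    disc, so membership in \<open>V\<close> bounds the composite by 1 on the whole disc.\<close>
  define V where "V = Hol_nbhd (cball 0 s) 1 (\<lambda>z. 0)"
  have V: "openin Hol_topology V"
    unfolding V_def using s(1) by (intro openin_Hol_nbhd zero_in_Hol_disc) auto
  have V0: "V \<subseteq> Hol_disc" "(\<lambda>z. 0) \<in> V"
    using zero_in_Hol_disc by (auto simp: V_def Hol_nbhd_def)
  have "?T f \<in> ?C" if f: "f \<in> V" for f
  proof (rule bounded_Hol_disc_is_disc_power_series)
    show "?T f \<in> Hol_disc"
      using composition_operator_in_Hol_disc[OF assms(1,2)] f V0(1) by blast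
    show "norm (?T f z) \<le> 1" if "z \<in> unit_disc" for z
      using f s(2)[OF that] that by (simp add: V_def Hol_nbhd_def composition_operator_def less_imp_le)
  qed
  then have "Hol_topology closure_of (?T ` V) \<subseteq> ?C"
    using compactin_imp_closedin[OF Hausdorff_space_Hol_topology compactin_disc_power_series_image]
    by (intro closure_of_minimal) auto
  then have "compactin Hol_topology (Hol_topology closure_of (?T ` V))"
    by (rule closed_compactin[OF compactin_disc_power_series_image]) simp
  then show ?thesis
    unfolding compact_operator_def topspace_Hol_topology
    using linear_composition_operator[OF assms(1,2)] V V0 by (intro conjI exI[of _ V]) simp_all
qed

theorem theorem2p5:
  fixes \<phi> :: "complex \<Rightarrow> complex"
  assumes "\<phi> holomorphic_on unit_disc"
    and "\<phi> ` unit_disc \<subseteq> unit_disc"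
  shows "compact_operator Hol_topology (composition_operator \<phi>) \<longleftrightarrow>
         (SUP z\<in>unit_disc. cmod (\<phi> z)) < 1"
proof
  assume "compact_operator Hol_topology (composition_operator \<phi>)"
  then obtain r where r: "r < 1" "\<And>z. z \<in> unit_disc \<Longrightarrow> norm (\<phi> z) \<le> r"
    using compact_composition_operator_imp_bound assms(2) by blast
  have "(SUP z\<in>unit_disc. cmod (\<phi> z)) \<le> r"
    using r(2) by (intro cSUP_least) simp_all
  then show "(SUP z\<in>unit_disc. cmod (\<phi> z)) < 1" using r(1) by linarith
next
  assume sup: "(SUP z\<in>unit_disc. cmod (\<phi> z)) < 1"
  \<comment> \<open>A real \<open>SUP\<close> bounds the values only when they are bounded above;
    here 1 is an upper bound.\<close>
  have "bdd_above ((\<lambda>z. cmod (\<phi> z)) ` unit_disc)"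
    using assms(2) by (intro bdd_aboveI[of _ 1]) (auto intro: less_imp_le)
  then show "compact_operator Hol_topology (composition_operator \<phi>)"
    by (intro compact_composition_operator[OF assms sup] cSUP_upper)
qed

end
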